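(* Let $n\in\mathbb N_0$, $x\in\mathbb C$, let $\alpha,\beta\in\mathbb C$ with $-\alpha,-\beta\notin\mathbb N_0$, and let $c,d\in\mathbb C\setminus\{0,1\}$. Then $$M_n(x;\alpha,c)=\frac{(\alpha-\beta)_n}{(\alpha)_n}\sum_{k=0}^{n}\frac{(\beta)_k(-n)_k}{k!\,(\beta-\alpha-n+1)_k}\,F_1\!\left(-n+k,-x,x;\beta-\alpha-n+k+1;\frac1c,\frac1d\right)M_k(x;\beta,d).$$
   Context: $\mathbb N_0=\{0,1,2,\dots\}$. Pochhammer symbol: $(a)_n=a(a+1)\cdots(a+n-1)$, with $(a)_0=1$. Generalized hypergeometric series: ${}_2F_1\!\left(\begin{matrix}a_1,\,a_2\\ b\end{matrix};z\right)=\sum_{k\ge0}\frac{(a_1)_k(a_2)_k}{(b)_k}\frac{z^k}{k!}$. Meixner polynomials: $M_n(x;\alpha,c)={}_2F_1\!\left(\begin{matrix}-n,\,-x\\ \alpha\end{matrix};1-\frac1c\right)$. Appell series: $F_1(a,b,b';c;x,y)=\sum_{m,n=0}^\infty\frac{(a)_{m+n}(b)_m(b')_n}{(c)_{m+n}}\frac{x^m}{m!}\frac{y^n}{n!}$.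
   Formalization: The identity is stated when (α−β)_n ≠ 0, since otherwise the denominator (β−α−n+1)_n vanishes (e.g. n=1, α=β); for all admissible α, β the right-hand side is shown to tend to M_n(x;α,c) through parameters with (α−β)_n ≠ 0. *)

theory Defs
  imports "HOL-Analysis.Analysis"
begin

definition hypergeom_2F1 :: "complex \<Rightarrow> complex \<Rightarrow> complex \<Rightarrow> complex \<Rightarrow> complex" where
  "hypergeom_2F1 a1 a2 b z =
     (\<Sum>k. pochhammer a1 k * pochhammer a2 k / pochhammer b k * (z ^ k / fact k))"

lemma hypergeom_2F1_eq_eval_fps:
  "hypergeom_2F1 a1 a2 b z = eval_fps (fps_hypergeo [a1, a2] [b] 1) z"
  by (simp add: hypergeom_2F1_def eval_fps_def)

definition Meixner :: "nat \<Rightarrow> complex \<Rightarrow> complex \<Rightarrow> complex \<Rightarrow> complex" where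
  "Meixner n x \<alpha> c = hypergeom_2F1 (- of_nat n) (- x) \<alpha> (1 - 1 / c)"

text \<open>
  If the first parameter is a non-positive integer \<open>-N\<close>, all terms with \<open>m + n > N\<close> vanish,
  even when \<open>pochhammer c (m + n)\<close> vanishes too (since \<open>0 / 0 = 0\<close>); this is the usual
  convention for terminating series.
\<close>

definition Appell_F1 ::
  "complex \<Rightarrow> complex \<Rightarrow> complex \<Rightarrow> complex \<Rightarrow> complex \<Rightarrow> complex \<Rightarrow> complex" where
  "Appell_F1 a b b' c x y =
     (\<Sum>\<^sub>\<infinity>(m, n)\<in>UNIV. pochhammer a (m + n) * pochhammer b m * pochhammer b' n
        / pochhammer c (m + n) * (x ^ m / fact m) * (y ^ n / fact n))"

text \<open>
  The connection formula between two Meixner families has the denominators \<open>(\<beta> - \<alpha> - n + 1)\<^sub>k\<close> and, inside \<open>F\<^sub>1\<close>,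
  \<open>(\<beta> - \<alpha> - n + k + 1)\<^sub>j\<close> with \<open>j \<le> n - k\<close>. All of them are non-zero precisely when
  \<open>(\<beta> - \<alpha> - n + 1)\<^sub>n = (-1)\<^sup>n (\<alpha> - \<beta>)\<^sub>n\<close> is, i.e. when \<open>\<alpha> - \<beta>\<close> is not one of
  \<open>0, -1, ..., -(n - 1)\<close>. At these exceptional parameters the right-hand side is of the form
  \<open>0 \<cdot> (1 / 0)\<close>; the singularity is removable, and the right-hand side is read as its limit in
  \<open>(\<alpha>, \<beta>)\<close> through non-exceptional parameters.
\<close>

end

theory Submission
  imports Defs
begin

text \<open>
  Everything rests on the formal power series \<open>(1 - z t)\<^sup>-\<^sup>a = (\<Sum>k. (a)\<^sub>k / k! z\<^sup>k t\<^sup>k)\<close>,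
  which multiply by adding exponents (\<open>one_minus_powr_fps_add\<close>, that is, Vandermonde's identity).
  The Meixner polynomials have the generating function
  \<open>(\<Sum>n. (\<alpha>)\<^sub>n / n! M\<^sub>n(x; \<alpha>, c) t\<^sup>n) = (1 - t/c)\<^sup>x (1 - t)\<^sup>-\<^sup>x\<^sup>-\<^sup>\<alpha>\<close>
  (\<open>Meixner_generating_function\<close>), and this series factors as
  \<open>[(1 - t/c)\<^sup>x (1 - t/d)\<^sup>-\<^sup>x (1 - t)\<^sup>\<beta>\<^sup>-\<^sup>\<alpha>] [(1 - t/d)\<^sup>x (1 - t)\<^sup>-\<^sup>x\<^sup>-\<^sup>\<beta>]\<close>.
  The second bracket generates the \<open>M\<^sub>k(x; \<beta>, d)\<close>. The coefficient of \<open>t\<^sup>N\<close> in the first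
  bracket is a triangular double sum over \<open>i + j \<le> N\<close> containing \<open>(\<alpha> - \<beta>)\<^bsub>N-i-j\<^esub> / (N-i-j)!\<close>;
  reversing this Pochhammer symbol turns the sum into a terminating Appell series \<open>F\<^sub>1\<close>
  (\<open>Appell_F1_generating_function\<close>).
  Comparing coefficients of \<open>t\<^sup>n\<close>, with one further reversal for \<open>N = n - k\<close>, is the
  connection formula (\<open>Meixner_connection\<close>).

  Reversal divides by \<open>(\<alpha> - \<beta>)\<^sub>n\<close>, whence the exceptional parameters. Near them nothing is
  left to compute: at every non-exceptional \<open>(a, b)\<close> close to \<open>(\<alpha>, \<beta>)\<close> the right-hand side equals
  \<open>M\<^sub>n(x; a, c)\<close>, a rational function of \<open>a\<close> without a pole at \<open>\<alpha>\<close>.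
\<close>

section \<open>Binomial series\<close>

text \<open>
  This is \<open>(1 - z t)\<^sup>-\<^sup>a\<close>. The sign of the exponent is chosen so that the coefficients are
  Pochhammer symbols rather than generalized binomial coefficients with alternating signs.
\<close>

definition one_minus_powr_fps :: "complex \<Rightarrow> complex \<Rightarrow> complex fps" where
  "one_minus_powr_fps a z = Abs_fps (\<lambda>k. pochhammer a k / fact k * z ^ k)"

lemma nth_one_minus_powr_fps [simp]:
  "fps_nth (one_minus_powr_fps a z) k = pochhammer a k / fact k * z ^ k"
  by (simp add: one_minus_powr_fps_def)

lemma pochhammer_add_over_fact:
  fixes a b :: complex
  shows "(\<Sum>i\<le>n. pochhammer a i / fact i * (pochhammer b (n - i) / fact (n - i))) =
         pochhammer (a + b) n / fact n"
proof -
  have "pochhammer (a + b) n / fact n =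
        (\<Sum>i\<le>n. of_nat (n choose i) * pochhammer a i * pochhammer b (n - i) / fact n)"
    by (simp add: pochhammer_binomial_sum sum_divide_distrib)
  also have "\<dots> = (\<Sum>i\<le>n. pochhammer a i / fact i * (pochhammer b (n - i) / fact (n - i)))"
    by (intro sum.cong refl) (simp add: binomial_fact field_simps)
  finally show ?thesis ..
qed

lemma one_minus_powr_fps_add:
  "one_minus_powr_fps a z * one_minus_powr_fps b z = one_minus_powr_fps (a + b) z"
proof (rule fps_ext)
  fix n
  have "fps_nth (one_minus_powr_fps a z * one_minus_powr_fps b z) n =
        (\<Sum>i\<le>n. pochhammer a i / fact i * (pochhammer b (n - i) / fact (n - i)) * z ^ n)"
    unfolding fps_mult_nth atLeast0AtMost
    by (intro sum.cong refl) (simp add: field_simps flip: power_add)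
  then show "fps_nth (one_minus_powr_fps a z * one_minus_powr_fps b z) n =
             fps_nth (one_minus_powr_fps (a + b) z) n"
    unfolding sum_distrib_right [symmetric] pochhammer_add_over_fact by simp
qed

lemma one_minus_powr_fps_0 [simp]: "one_minus_powr_fps 0 z = 1"
  by (rule fps_ext) (simp add: pochhammer_0_left)

text \<open>
  Reading a Pochhammer symbol from its last factor downwards; for \<open>e = 1\<close> the statement concerns
  factorials, since \<open>(1)\<^sub>N = N!\<close>.
\<close>

lemma pochhammer_reverse:
  fixes e :: complex
  assumes "s \<le> N"
  shows "pochhammer e N = (- 1) ^ s * pochhammer e (N - s) * pochhammer (1 - e - of_nat N) s"
proof -
  have "pochhammer (1 - e - of_nat N) s = (- 1) ^ s * pochhammer (e + of_nat (N - s)) s"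
    using pochhammer_minus[of "e + of_nat N - 1" s] assms
    by (simp add: of_nat_diff algebra_simps)
  moreover have "pochhammer e N = pochhammer e (N - s) * pochhammer (e + of_nat (N - s)) s"
    using pochhammer_product'[of e "N - s" s] assms by simp
  ultimately show ?thesis
    by (simp flip: power_mult_distrib)
qed

lemma pochhammer_reverse_nonzero:
  fixes e :: complex
  assumes "pochhammer e N \<noteq> 0" and "s \<le> N"
  shows "pochhammer (1 - e - of_nat N) s \<noteq> 0"
  using pochhammer_reverse[OF assms(2), of e] assms(1) by auto

lemma pochhammer_uminus_of_nat:
  assumes "s \<le> N"
  shows "pochhammer (- of_nat N :: complex) s = (- 1) ^ s * fact N / fact (N - s)"
proof -
  have "fact N = (- 1) ^ s * fact (N - s) * pochhammer (- of_nat N :: complex) s"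
    using pochhammer_reverse[OF assms, of 1] by (simp flip: pochhammer_fact)
  then show ?thesis
    by simp
qed

lemma pochhammer_over_fact_reverse:
  fixes e :: complex
  assumes "pochhammer e N \<noteq> 0" and "s \<le> N"
  shows "pochhammer e (N - s) / fact (N - s) =
         pochhammer e N / fact N * (pochhammer (- of_nat N) s / pochhammer (1 - e - of_nat N) s)"
  unfolding pochhammer_reverse[OF assms(2), of e] pochhammer_uminus_of_nat[OF assms(2)]
  using pochhammer_reverse_nonzero[OF assms] by simp

section \<open>The generating function of the Meixner polynomials\<close>

lemma Meixner_finite_sum:
  "Meixner n x \<alpha> c =
     (\<Sum>k\<le>n. pochhammer (- of_nat n) k * pochhammer (- x) k / pochhammer \<alpha> k *
       ((1 - 1 / c) ^ k / fact k))"
  unfolding Meixner_def hypergeom_2F1_def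
  by (rule suminf_finite) (auto simp: pochhammer_of_nat_eq_0_lemma)

text \<open>
  Formally \<open>(1 - (1 - w) t)\<^sup>-\<^sup>b = (1 - t)\<^sup>-\<^sup>b (1 + w t / (1 - t))\<^sup>-\<^sup>b\<close>; multiplying by \<open>(1 - t)\<^sup>-\<^sup>a\<close>
  and expanding in powers of \<open>w\<close>, the \<open>j\<close>-th term is a multiple of \<open>t\<^sup>j (1 - t)\<^sup>-\<^sup>a\<^sup>-\<^sup>b\<^sup>-\<^sup>j\<close>.
  On coefficients this is the binomial theorem for \<open>(1 - w)\<^sup>i\<close>, an exchange of summations, and
  Vandermonde's identity.
\<close>

lemma nth_one_minus_powr_fps_shift:
  "fps_nth (one_minus_powr_fps b (1 - w) * one_minus_powr_fps a 1) n =
     (\<Sum>j\<le>n. pochhammer b j / fact j * (- w) ^ j *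
       (pochhammer (a + b + of_nat j) (n - j) / fact (n - j)))"
proof -
  define g where "g j l = pochhammer b (j + l) / (fact j * fact l) * (- w) ^ j *
    (pochhammer a (n - (j + l)) / fact (n - (j + l)))" for j l
  have "fps_nth (one_minus_powr_fps b (1 - w) * one_minus_powr_fps a 1) n =
        (\<Sum>i\<le>n. pochhammer b i / fact i * (1 - w) ^ i * (pochhammer a (n - i) / fact (n - i)))"
    by (simp add: fps_mult_nth atLeast0AtMost)
  also have "\<dots> = (\<Sum>i\<le>n. \<Sum>j\<le>i. g j (i - j))"
  proof (intro sum.cong refl)
    fix i
    have "(1 - w) ^ i = (\<Sum>j\<le>i. of_nat (i choose j) * (- w) ^ j)"
      using binomial_ring[of "- w" 1 i] by simp
    then show "pochhammer b i / fact i * (1 - w) ^ i * (pochhammer a (n - i) / fact (n - i)) =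
               (\<Sum>j\<le>i. g j (i - j))"
      by (simp only: sum_distrib_left sum_distrib_right)
         (intro sum.cong refl, simp add: g_def binomial_fact)
  qed
  also have "\<dots> = (\<Sum>(j, l)\<in>{(j, l). j + l \<le> n}. g j l)"
    by (rule sum.triangle_reindex_eq [symmetric])
  also have "{(j, l). j + l \<le> n} = Sigma {..n} (\<lambda>j. {..n - j})"
    by auto
  also have "(\<Sum>(j, l)\<in>\<dots>. g j l) = (\<Sum>j\<le>n. \<Sum>l\<le>n - j. g j l)"
    by (simp add: sum.Sigma)
  also have "\<dots> = (\<Sum>j\<le>n. pochhammer b j / fact j * (- w) ^ j *
       (pochhammer (a + b + of_nat j) (n - j) / fact (n - j)))"
  proof (intro sum.cong refl)
    fix j
    have "(\<Sum>l\<le>n - j. g j l) = pochhammer b j / fact j * (- w) ^ j *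
      (\<Sum>l\<le>n - j. pochhammer (b + of_nat j) l / fact l *
         (pochhammer a (n - j - l) / fact (n - j - l)))"
      unfolding sum_distrib_left
      by (intro sum.cong refl) (simp add: g_def pochhammer_product' mult_ac)
    then show "(\<Sum>l\<le>n - j. g j l) = pochhammer b j / fact j * (- w) ^ j *
       (pochhammer (a + b + of_nat j) (n - j) / fact (n - j))"
      unfolding pochhammer_add_over_fact by (simp only: add_ac)
  qed
  finally show ?thesis .
qed

text \<open>
  With \<open>w = 1 - 1/c\<close>, \<open>b = -x\<close> and \<open>a = x + \<alpha>\<close> the parameter \<open>a + b + j\<close> of the expansion loses its
  dependence on \<open>x\<close>, and the expansion becomes the series of \<open>M\<^sub>n\<close> at argument \<open>w\<close>. The assumption
  concerns a single \<open>n\<close>, because it has to hold throughout a neighbourhood of a given \<open>\<alpha>\<close>.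
\<close>

lemma Meixner_generating_function:
  assumes "pochhammer \<alpha> n \<noteq> 0"
  shows "fps_nth (one_minus_powr_fps (- x) (1 / c) * one_minus_powr_fps (x + \<alpha>) 1) n =
         pochhammer \<alpha> n / fact n * Meixner n x \<alpha> c"
proof -
  define w where "w = 1 - 1 / c"
  have c: "1 / c = 1 - w"
    by (simp add: w_def)
  have "fps_nth (one_minus_powr_fps (- x) (1 / c) * one_minus_powr_fps (x + \<alpha>) 1) n =
        (\<Sum>j\<le>n. pochhammer (- x) j / fact j * (- w) ^ j *
          (pochhammer (\<alpha> + of_nat j) (n - j) / fact (n - j)))"
    unfolding c nth_one_minus_powr_fps_shift by simp
  also have "\<dots> = (\<Sum>j\<le>n. pochhammer \<alpha> n / fact n *
    (pochhammer (- of_nat n) j * pochhammer (- x) j / pochhammer \<alpha> j * (w ^ j / fact j)))"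
  proof (intro sum.cong refl)
    fix j assume "j \<in> {..n}"
    then have j: "j \<le> n"
      by simp
    have nz: "pochhammer \<alpha> j \<noteq> 0"
      using pochhammer_neq_0_mono[OF assms j] .
    show "pochhammer (- x) j / fact j * (- w) ^ j *
          (pochhammer (\<alpha> + of_nat j) (n - j) / fact (n - j)) =
        pochhammer \<alpha> n / fact n *
          (pochhammer (- of_nat n) j * pochhammer (- x) j / pochhammer \<alpha> j * (w ^ j / fact j))"
      unfolding pochhammer_uminus_of_nat[OF j] pochhammer_product[OF j, of \<alpha>]
      using nz by (simp add: power_minus[of w] mult_ac)
  qed
  also have "\<dots> = pochhammer \<alpha> n / fact n * Meixner n x \<alpha> c"
    by (simp add: Meixner_finite_sum w_def sum_distrib_left)
  finally show ?thesis .
qed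

lemma tendsto_Meixner:
  assumes "pochhammer \<alpha> n \<noteq> 0"
  shows "((\<lambda>a. Meixner n x a c) \<longlongrightarrow> Meixner n x \<alpha> c) (nhds \<alpha>)"
proof -
  have poch: "((\<lambda>a. pochhammer a k) \<longlongrightarrow> pochhammer \<alpha> k) (nhds \<alpha>)" for k
    using isCont_pochhammer[of \<alpha> k]
      tendsto_at_iff_tendsto_nhds[of "\<lambda>a. pochhammer a k" \<alpha>]
    by (simp only: isCont_def)
  show ?thesis
    unfolding Meixner_finite_sum
    by (intro tendsto_intros poch) (use pochhammer_neq_0_mono[OF assms] in auto)
qed

section \<open>Terminating Appell series as power series coefficients\<close>

lemma Appell_F1_finite_sum:
  "Appell_F1 (- of_nat N) b b' c x y =
     (\<Sum>s\<le>N. \<Sum>i\<le>s. pochhammer (- of_nat N) s / pochhammer c s *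
       (pochhammer b i / fact i * x ^ i * (pochhammer b' (s - i) / fact (s - i) * y ^ (s - i))))"
proof -
  have sub: "{(m, k). m + k \<le> N} \<subseteq> {..N} \<times> {..N}"
    by auto
  have fin: "finite {(m, k). m + k \<le> N}"
    by (rule finite_subset[OF sub]) simp
  have "Appell_F1 (- of_nat N) b b' c x y =
    (\<Sum>\<^sub>\<infinity>(m, k)\<in>{(m, k). m + k \<le> N}. pochhammer (- of_nat N) (m + k) / pochhammer c (m + k) *
       (pochhammer b m / fact m * x ^ m * (pochhammer b' k / fact k * y ^ k)))"
    unfolding Appell_F1_def
    by (rule infsum_cong_neutral) (auto simp: pochhammer_of_nat_eq_0_lemma mult_ac)
  also have "\<dots> = (\<Sum>(m, k)\<in>{(m, k). m + k \<le> N}.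
       pochhammer (- of_nat N) (m + k) / pochhammer c (m + k) *
       (pochhammer b m / fact m * x ^ m * (pochhammer b' k / fact k * y ^ k)))"
    using fin by simp
  also have "\<dots> = (\<Sum>s\<le>N. \<Sum>i\<le>s.
       pochhammer (- of_nat N) (i + (s - i)) / pochhammer c (i + (s - i)) *
       (pochhammer b i / fact i * x ^ i * (pochhammer b' (s - i) / fact (s - i) * y ^ (s - i))))"
    by (rule sum.triangle_reindex_eq)
  finally show ?thesis
    by simp
qed

text \<open>
  \<open>F\<^sub>1(-N, b, b'; 1 - e - N; x, y)\<close> is, up to normalization, the coefficient of \<open>t\<^sup>N\<close> in
  \<open>(1 - x t)\<^sup>-\<^sup>b (1 - y t)\<^sup>-\<^sup>b\<^sup>' (1 - t)\<^sup>-\<^sup>e\<close>: the quotient \<open>(-N)\<^sub>s / (1 - e - N)\<^sub>s\<close> in the series is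
  what reversal makes of the coefficient of \<open>t\<^bsup>N-s\<^esup>\<close> in the last factor.
\<close>

lemma Appell_F1_generating_function:
  assumes "pochhammer e N \<noteq> 0"
  shows "fps_nth (one_minus_powr_fps b x * one_minus_powr_fps b' y * one_minus_powr_fps e 1) N =
         pochhammer e N / fact N * Appell_F1 (- of_nat N) b b' (1 - e - of_nat N) x y"
proof -
  have "fps_nth (one_minus_powr_fps b x * one_minus_powr_fps b' y * one_minus_powr_fps e 1) N =
        (\<Sum>s\<le>N. (\<Sum>i\<le>s. pochhammer b i / fact i * x ^ i *
            (pochhammer b' (s - i) / fact (s - i) * y ^ (s - i))) *
          (pochhammer e (N - s) / fact (N - s)))"
    by (simp add: fps_mult_nth atLeast0AtMost)
  also have "\<dots> = (\<Sum>s\<le>N. pochhammer e N / fact N * (\<Sum>i\<le>s.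
          pochhammer (- of_nat N) s / pochhammer (1 - e - of_nat N) s *
          (pochhammer b i / fact i * x ^ i *
            (pochhammer b' (s - i) / fact (s - i) * y ^ (s - i)))))"
  proof (intro sum.cong refl)
    fix s assume "s \<in> {..N}"
    then have "s \<le> N"
      by simp
    show "(\<Sum>i\<le>s. pochhammer b i / fact i * x ^ i *
            (pochhammer b' (s - i) / fact (s - i) * y ^ (s - i))) *
          (pochhammer e (N - s) / fact (N - s)) =
        pochhammer e N / fact N * (\<Sum>i\<le>s.
          pochhammer (- of_nat N) s / pochhammer (1 - e - of_nat N) s *
          (pochhammer b i / fact i * x ^ i *
            (pochhammer b' (s - i) / fact (s - i) * y ^ (s - i))))"
      unfolding pochhammer_over_fact_reverse[OF assms \<open>s \<le> N\<close>]
      unfolding sum_distrib_left [symmetric] by (rule mult.commute [THEN trans]) (rule mult.assoc)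
  qed
  also have "\<dots> = pochhammer e N / fact N * Appell_F1 (- of_nat N) b b' (1 - e - of_nat N) x y"
    by (simp only: Appell_F1_finite_sum sum_distrib_left)
  finally show ?thesis .
qed

section \<open>The connection formula\<close>

text \<open>
  The denominators vanish on finitely many hyperplanes only. Stating their non-vanishing by
  Pochhammer symbols, which are continuous, makes the formula available at all non-exceptional
  parameters in a neighbourhood of \<open>(\<alpha>, \<beta>)\<close>.
\<close>

lemma Meixner_connection:
  fixes n :: nat and x \<alpha> \<beta> c d :: complex
  assumes \<alpha>: "pochhammer \<alpha> n \<noteq> 0" and \<beta>: "pochhammer \<beta> n \<noteq> 0"
    and \<alpha>\<beta>: "pochhammer (\<alpha> - \<beta>) n \<noteq> 0"
  shows "Meixner n x \<alpha> c = pochhammer (\<alpha> - \<beta>) n / pochhammer \<alpha> n *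
           (\<Sum>k=0..n. pochhammer \<beta> k * pochhammer (- of_nat n) k
              / (fact k * pochhammer (\<beta> - \<alpha> - of_nat n + 1) k)
              * Appell_F1 (- of_nat n + of_nat k) (- x) x
                  (\<beta> - \<alpha> - of_nat n + of_nat k + 1) (1 / c) (1 / d)
              * Meixner k x \<beta> d)"
    (is "_ = _ / _ * sum ?term _")
proof -
  let ?P = one_minus_powr_fps
  have cancel: "?P x (1 / d) * ?P (- x) (1 / d) = 1"
    by (simp add: one_minus_powr_fps_add)
  have split: "?P (x + \<alpha>) 1 = ?P (x + \<beta>) 1 * ?P (\<alpha> - \<beta>) 1"
    by (simp add: one_minus_powr_fps_add)
  have factor: "?P (- x) (1 / c) * ?P (x + \<alpha>) 1 =
      (?P (- x) (1 / d) * ?P (x + \<beta>) 1) * (?P (- x) (1 / c) * ?P x (1 / d) * ?P (\<alpha> - \<beta>) 1)"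
    (is "_ = ?G * ?H")
  proof -
    have "?G * ?H = (?P x (1 / d) * ?P (- x) (1 / d)) *
        (?P (- x) (1 / c) * (?P (x + \<beta>) 1 * ?P (\<alpha> - \<beta>) 1))"
      by (simp only: mult_ac)
    then show ?thesis
      by (simp only: cancel split mult_1)
  qed
  have "pochhammer \<alpha> n / fact n * Meixner n x \<alpha> c = (\<Sum>k=0..n. fps_nth ?G k * fps_nth ?H (n - k))"
    by (simp only: Meixner_generating_function[OF \<alpha>, symmetric] factor fps_mult_nth)
  also have "\<dots> = (\<Sum>k=0..n. pochhammer (\<alpha> - \<beta>) n / fact n * ?term k)"
  proof (intro sum.cong refl)
    fix k assume "k \<in> {0..n}"
    then have k: "k \<le> n"
      by simp
    have "fps_nth ?G k = pochhammer \<beta> k / fact k * Meixner k x \<beta> d"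
      using pochhammer_neq_0_mono[OF \<beta> k] by (rule Meixner_generating_function)
    moreover have "fps_nth ?H (n - k) = pochhammer (\<alpha> - \<beta>) (n - k) / fact (n - k) *
        Appell_F1 (- of_nat n + of_nat k) (- x) x
          (\<beta> - \<alpha> - of_nat n + of_nat k + 1) (1 / c) (1 / d)"
      unfolding Appell_F1_generating_function[OF pochhammer_neq_0_mono[OF \<alpha>\<beta> diff_le_self]]
      by (intro arg_cong2[where f = "(*)"] refl arg_cong2[where f = "\<lambda>a e. Appell_F1 a _ _ e _ _"])
         (use k in \<open>simp_all add: of_nat_diff\<close>)
    moreover have "pochhammer (\<alpha> - \<beta>) (n - k) / fact (n - k) =
        pochhammer (\<alpha> - \<beta>) n / fact n *
          (pochhammer (- of_nat n) k / pochhammer (\<beta> - \<alpha> - of_nat n + 1) k)"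
      using pochhammer_over_fact_reverse[OF \<alpha>\<beta> k] by (simp add: algebra_simps)
    ultimately show "fps_nth ?G k * fps_nth ?H (n - k) =
        pochhammer (\<alpha> - \<beta>) n / fact n * ?term k"
      by (simp only:) (simp add: mult_ac)
  qed
  also have "\<dots> = pochhammer (\<alpha> - \<beta>) n / fact n * sum ?term {0..n}"
    by (rule sum_distrib_left [symmetric])
  finally have "pochhammer \<alpha> n * Meixner n x \<alpha> c = pochhammer (\<alpha> - \<beta>) n * sum ?term {0..n}"
    by simp
  then show ?thesis
    using \<alpha> by (simp add: field_simps)
qed

lemma pochhammer_nonzero_if_uminus_notin_Nats:
  fixes a :: complex
  assumes "- a \<notin> \<nat>"
  shows "pochhammer a n \<noteq> 0"
  using assms by (auto simp: pochhammer_eq_0_iff)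

theorem theorem5:
  fixes n :: nat and x \<alpha> \<beta> c d :: complex
  assumes "- \<alpha> \<notin> \<nat>" and "- \<beta> \<notin> \<nat>"
    and "c \<noteq> 0" and "c \<noteq> 1" and "d \<noteq> 0" and "d \<noteq> 1"
  shows "let R = (\<lambda>a b. pochhammer (a - b) n / pochhammer a n *
           (\<Sum>k=0..n. pochhammer b k * pochhammer (- of_nat n) k
              / (fact k * pochhammer (b - a - of_nat n + 1) k)
              * Appell_F1 (- of_nat n + of_nat k) (- x) x
                  (b - a - of_nat n + of_nat k + 1) (1 / c) (1 / d)
              * Meixner k x b d))
         in (pochhammer (\<alpha> - \<beta>) n \<noteq> 0 \<longrightarrow> Meixner n x \<alpha> c = R \<alpha> \<beta>) \<and>
            ((\<lambda>(a, b). R a b) \<longlongrightarrow> Meixner n x \<alpha> c)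
              (at (\<alpha>, \<beta>) within {(a, b). pochhammer (a - b) n \<noteq> 0})"
proof -
  define R where "R = (\<lambda>a b. pochhammer (a - b) n / pochhammer a n *
           (\<Sum>k=0..n. pochhammer b k * pochhammer (- of_nat n) k
              / (fact k * pochhammer (b - a - of_nat n + 1) k)
              * Appell_F1 (- of_nat n + of_nat k) (- x) x
                  (b - a - of_nat n + of_nat k + 1) (1 / c) (1 / d)
              * Meixner k x b d))"
  have R: "R a b = Meixner n x a c"
    if "pochhammer a n \<noteq> 0" "pochhammer b n \<noteq> 0" "pochhammer (a - b) n \<noteq> 0" for a b
    using Meixner_connection[OF that, of x c d] by (simp add: R_def)
  note nz = pochhammer_nonzero_if_uminus_notin_Nats[OF assms(1)]
            pochhammer_nonzero_if_uminus_notin_Nats[OF assms(2)]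
  let ?F = "at (\<alpha>, \<beta>) within {(a, b). pochhammer (a - b) n \<noteq> 0}"
  have fst: "(fst \<longlongrightarrow> \<alpha>) ?F" and snd: "(snd \<longlongrightarrow> \<beta>) ?F"
    using tendsto_fst[OF tendsto_ident_at] tendsto_snd[OF tendsto_ident_at] by fastforce+
  have poch: "((\<lambda>p. pochhammer (f p) n) \<longlongrightarrow> pochhammer l n) ?F"
    if "(f \<longlongrightarrow> l) ?F" for f :: "complex \<times> complex \<Rightarrow> complex" and l
    using isCont_tendsto_compose[OF isCont_pochhammer that] .
  have "\<forall>\<^sub>F p in ?F. pochhammer (fst p) n \<noteq> 0"
    using tendsto_imp_eventually_ne[OF poch[OF fst] nz(1)] .
  moreover have "\<forall>\<^sub>F p in ?F. pochhammer (snd p) n \<noteq> 0"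
    using tendsto_imp_eventually_ne[OF poch[OF snd] nz(2)] .
  moreover have "\<forall>\<^sub>F p in ?F. p \<in> {(a, b). pochhammer (a - b) n \<noteq> 0}"
    by (simp add: eventually_at_filter)
  ultimately have "\<forall>\<^sub>F p in ?F. Meixner n x (fst p) c = (case p of (a, b) \<Rightarrow> R a b)"
    by eventually_elim (auto simp: R)
  moreover have "((\<lambda>p. Meixner n x (fst p) c) \<longlongrightarrow> Meixner n x \<alpha> c) ?F"
    using filterlim_compose[OF tendsto_Meixner[OF nz(1)] fst] .
  ultimately have "((\<lambda>(a, b). R a b) \<longlongrightarrow> Meixner n x \<alpha> c) ?F"
    using Lim_transform_eventually by blast
  moreover have "pochhammer (\<alpha> - \<beta>) n \<noteq> 0 \<longrightarrow> Meixner n x \<alpha> c = R \<alpha> \<beta>"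
    using R nz by simp
  ultimately show ?thesis
    unfolding R_def Let_def by blast
qed

end
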